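(* Let $Y$ be a locally compact metric space and let $\mathcal I$ be a countable index set. For each $k\in\mathbb N$ let $\mathcal{X}_k=\big(X_k,\{d_{k,s}:s\in\mathcal I\},\{h_{k,s}:s\in\mathcal I\}\big)$ be a Diophantine system, let $f_k:\mathbb R_{>0}\to\mathbb R_{>0}$ be non-increasing, and let $\varphi_k:Y\to X_k$ be continuous. Let $\mathcal{L}$ and $\mathcal{R}$ be countable collections of closed subsets of $Y$ such that $\mathcal{L}$ is totally dense relative to $\mathcal{R}$, $\mathcal{L}$ respects $\mathcal{R}$, and $\mathcal{L}$ is aligned with $\mathcal{X}_k$ via $\varphi_k$ for every $k\in\mathbb N$. Then: (a) the set $\bigcap_{k\in\mathbb N}\varphi_k^{-1}\big(\operatorname{UA}_{\mathcal{X}_k}(f_k)\big)\smallsetminus\bigcup_{R\in\mathcal{R}}R$ is dense in $Y$; (b) if in addition every $L\in\mathcal{L}$ is either connected or has no isolated points, then this set is uncountable.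
   Context: A Diophantine system is a triple $\mathcal{X}=(X,\{d_s:s\in\mathcal I\},\{h_s:s\in\mathcal I\})$ where $X$ is a topological space, $\mathcal I$ a countable index set, each $d_s:X\to[0,\infty)$ is continuous (a generalized distance function), and each $h_s>0$ is a real number (the height). Given $f:\mathbb R_{>0}\to\mathbb R_{>0}$, a point $x\in X$ is $(\mathcal{X},f)$-uniform if for every sufficiently large $t>0$ there is $s\in\mathcal I$ with $d_s(x)\le f(t)$ and $h_s\le t$; $\operatorname{UA}_{\mathcal{X}}(f)$ denotes the set of such points. For a metric space $Y$ and collections $\mathcal{L},\mathcal{R}$ of proper closed subsets of $Y$, $\mathcal{L}$ is totally dense relative to $\mathcal{R}$ if (i) $\bigcup_{L\in\mathcal{L}}L$ is dense in $Y$, and (ii) for every open $W\subset Y$, every $L\in\mathcal{L}$ with $L\cap W\neq\varnothing$ and every $R\in\mathcal{R}$, there exists $L'\in\mathcal{L}$ with $L'\cap L\cap W\neq\varnothing$ and $L'\not\subset R$. $\mathcal{L}$ respects a subset $R\subset Y$ if whenever $L\in\mathcal{L}$ and $L\cap R$ has nonempty interior in $L$ (in the topology induced from $Y$), then $L\subset R$; $\mathcal{L}$ respects $\mathcal{R}$ if it respects every $R\in\mathcal{R}$. $\mathcal{L}$ is aligned with a Diophantine system $(X,\{d_s\},\{h_s\})$ via a map $\varphi:Y\to X$ if for every $L\in\mathcal{L}$ there exists $s\in\mathcal I$ with $d_s\equiv 0$ on $\varphi(L)$.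
   Formalization: Part (b) additionally assumes that some L in the collection has at least two points; without this it fails, e.g. for Y a two-point discrete space, the L's its two singletons, no R's, and all distance functions zero. Y is taken nonempty. *)

theory Defs
  imports "HOL-Analysis.Analysis"
begin

text \<open>The space is an abstract topology (with an explicit carrier) rather than a type, so that a
  sequence of systems may live on different, unrelated spaces.  The functions and heights are
  families, and only their values at indices in \<open>index_set\<close> matter.\<close>

record ('x, 'i) dioph_system =
  space_of :: "'x topology"
  index_set :: "'i set"
  dist_fun :: "'i \<Rightarrow> 'x \<Rightarrow> real"
  height :: "'i \<Rightarrow> real"

definition diophantine_system :: "('x, 'i) dioph_system \<Rightarrow> bool" where
  "diophantine_system \<X> \<longleftrightarrow>
     countable (index_set \<X>) \<and>
     (\<forall>s\<in>index_set \<X>. continuous_map (space_of \<X>) (top_of_set {0..}) (dist_fun \<X> s)) \<and>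
     (\<forall>s\<in>index_set \<X>. height \<X> s > 0)"

definition UA :: "('x, 'i) dioph_system \<Rightarrow> (real \<Rightarrow> real) \<Rightarrow> 'x set" where
  "UA \<X> f = {x \<in> topspace (space_of \<X>).
     \<forall>\<^sub>F t in at_top. \<exists>s\<in>index_set \<X>. dist_fun \<X> s x \<le> f t \<and> height \<X> s \<le> t}"

definition totally_dense_rel :: "'y::metric_space set set \<Rightarrow> 'y set set \<Rightarrow> bool" where
  "totally_dense_rel \<L> \<R> \<longleftrightarrow>
     (\<forall>A\<in>\<L> \<union> \<R>. closed A \<and> A \<noteq> UNIV) \<and>
     closure (\<Union>\<L>) = UNIV \<and>
     (\<forall>W. open W \<longrightarrow> (\<forall>L\<in>\<L>. L \<inter> W \<noteq> {} \<longrightarrow> (\<forall>R\<in>\<R>.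
        \<exists>L'\<in>\<L>. L' \<inter> L \<inter> W \<noteq> {} \<and> \<not> L' \<subseteq> R)))"

definition respects_set :: "'y::metric_space set set \<Rightarrow> 'y set \<Rightarrow> bool" where
  "respects_set \<L> R \<longleftrightarrow>
     (\<forall>L\<in>\<L>. (top_of_set L) interior_of (L \<inter> R) \<noteq> {} \<longrightarrow> L \<subseteq> R)"

definition respects_family :: "'y::metric_space set set \<Rightarrow> 'y set set \<Rightarrow> bool" where
  "respects_family \<L> \<R> \<longleftrightarrow> (\<forall>R\<in>\<R>. respects_set \<L> R)"

definition aligned_via :: "'y set set \<Rightarrow> ('x, 'i) dioph_system \<Rightarrow> ('y \<Rightarrow> 'x) \<Rightarrow> bool" where
  "aligned_via \<L> \<X> \<phi> \<longleftrightarrow>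
     (\<forall>L\<in>\<L>. \<exists>s\<in>index_set \<X>. \<forall>x\<in>\<phi> ` L. dist_fun \<X> s x = 0)"

end

theory Submission
  imports Defs
begin

text \<open>Nested compact neighbourhoods \<open>closure (U (n+1)) \<subseteq> U n\<close> are built along a chain of sets
  \<open>L n \<in> \<L>\<close> with \<open>L n \<inter> U n \<noteq> {}\<close>, where \<open>L (n+1)\<close> meets \<open>L n\<close> inside \<open>U n\<close> and is not contained in
  the \<open>n\<close>-th set of \<open>\<R>\<close>; as \<open>\<L>\<close> respects \<open>\<R>\<close>, the next neighbourhood can avoid that set.
  The function vanishing on \<open>L n\<close> is small near \<open>L n \<inter> L (n+1)\<close>, hence it serves all times between
  the height belonging to \<open>L n\<close> and the one belonging to \<open>L (n+1)\<close>, and the limit point is uniform.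

  For uncountability, if the set were countable, its singletons could be added to \<open>\<R>\<close>, after
  discarding from \<open>\<L>\<close> the sets with at most one point: the construction never needs them, because a
  set that meets \<open>L \<subseteq> R\<close> without being contained in \<open>R\<close> has two points.\<close>

text \<open>\<open>T\<close> need not be monotone, so the least \<open>n \<ge> k\<close> with
  \<open>t < T (Suc n)\<close> is taken; it exists because \<open>T\<close> is unbounded. Minimality
  gives \<open>T n \<le> t\<close> unless \<open>n = k\<close>, where it is assumed.\<close>

lemma exists_straddling_step:
  fixes T :: "nat \<Rightarrow> real"
  assumes "\<And>n. real n \<le> T n" "T k \<le> t"
  obtains n where "k \<le> n" "T n \<le> t" "t < T (Suc n)"
proof -
  obtain m where m: "t < real m" using reals_Archimedean2 by blast
  have ex: "\<exists>n\<ge>k. t < T (Suc n)"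
  proof (intro exI conjI)
    show "k \<le> max k m" by simp
    have "t < real (Suc (max k m))" using m by linarith
    also have "\<dots> \<le> T (Suc (max k m))" by (rule assms)
    finally show "t < T (Suc (max k m))" .
  qed
  define n where "n = (LEAST n. k \<le> n \<and> t < T (Suc n))"
  have n: "k \<le> n \<and> t < T (Suc n)"
    unfolding n_def using ex by (rule LeastI_ex)
  moreover have "T n \<le> t"
  proof (cases "n = k")
    case False
    then obtain p where p: "n = Suc p" "k \<le> p" using n by (cases n) auto
    then have "p < (LEAST n. k \<le> n \<and> t < T (Suc n))" unfolding n_def by simp
    then have "\<not> (k \<le> p \<and> t < T (Suc p))" by (rule not_less_Least)
    then show ?thesis using p by auto
  qed (use assms in auto)
  ultimately show thesis using that by blast
qed

lemma locally_compact_neighbourhood: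
  fixes x :: "'y::metric_space"
  assumes lc: "locally compact (UNIV :: 'y set)" and "open V" "x \<in> V"
  obtains U where "open U" "x \<in> U" "closure U \<subseteq> V" "compact (closure U)"
proof -
  have "openin (top_of_set UNIV) V" using assms by simp
  then obtain U K where *: "openin (top_of_set UNIV) U" "compact K" "x \<in> U" "U \<subseteq> K" "K \<subseteq> V"
    using lc \<open>x \<in> V\<close> unfolding locally_def by meson
  then have sub: "closure U \<subseteq> K" by (simp add: closure_minimal compact_imp_closed)
  have "compact (closure U)"
    using compact_Int_closed[OF \<open>compact K\<close> closed_closure[of U]] sub by (simp add: Int_absorb1)
  then show thesis using that * sub by auto
qed

text \<open>The family only has to have one member meeting \<open>W\<close>; so the lemma yields
  density when \<open>W\<close> varies, and applies again to a modified pair of families in the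
  proof of uncountability. The maps \<open>g k s\<close> stand for the distance functions pulled
  back to \<open>'y\<close>.\<close>

lemma exists_uniform_point:
  fixes g :: "nat \<Rightarrow> 'i \<Rightarrow> 'y::metric_space \<Rightarrow> real" and h :: "nat \<Rightarrow> 'i \<Rightarrow> real"
  assumes lc: "locally compact (UNIV :: 'y set)"
    and cont: "\<And>k s. s \<in> \<I> \<Longrightarrow> continuous_on UNIV (g k s)"
    and pos: "\<And>k t. t > 0 \<Longrightarrow> f k t > (0::real)"
    and anti: "\<And>k. antimono_on {0<..} (f k)"
    and align: "\<And>k L. L \<in> \<L> \<Longrightarrow> \<exists>s\<in>\<I>. \<forall>x\<in>L. g k s x = 0"
    and "countable \<R>" and closed: "\<And>R. R \<in> \<R> \<Longrightarrow> closed R"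
    and step: "\<And>W L R. open W \<Longrightarrow> L \<in> \<L> \<Longrightarrow> L \<inter> W \<noteq> {} \<Longrightarrow> R \<in> \<R> \<Longrightarrow>
      \<exists>L'\<in>\<L>. L' \<inter> L \<inter> W \<noteq> {} \<and> \<not> L' \<subseteq> R"
    and resp: "respects_family \<L> \<R>"
    and W: "open W" "L0 \<in> \<L>" "L0 \<inter> W \<noteq> {}"
  shows "\<exists>x\<in>W - \<Union>\<R>. \<forall>k. \<forall>\<^sub>F t in at_top. \<exists>s\<in>\<I>. g k s x \<le> f k t \<and> h k s \<le> t"
proof -
  \<comment> \<open>Adding the empty set makes the family enumerable even if it was empty.\<close>
  define Rs where "Rs = from_nat_into (insert {} \<R>)"
  have Rs: "range Rs = insert {} \<R>"
    unfolding Rs_def using \<open>countable \<R>\<close> by (intro range_from_nat_into) auto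
  have closed_Rs: "closed (Rs n)" for n
    using Rs closed by (metis closed_empty insertE rangeI)
  have step_Rs: "\<exists>L'\<in>\<L>. L' \<inter> L \<inter> V \<noteq> {} \<and> \<not> L' \<subseteq> Rs n"
    if "open V" "L \<in> \<L>" "L \<inter> V \<noteq> {}" for V L n
  proof (cases "Rs n = {}")
    case True
    then show ?thesis using that by (intro bexI[of _ L]) auto
  next
    case False
    then have "Rs n \<in> \<R>" using Rs by (metis insertE rangeI)
    then show ?thesis by (rule step[OF that])
  qed
  \<comment> \<open>Respect enters here: a nonempty relatively open piece of \<open>L\<close> inside
    \<open>Rs n\<close> would force \<open>L \<subseteq> Rs n\<close>. The added empty set cannot
    contain such a piece.\<close>
  have avoid: "\<not> L \<inter> V \<subseteq> Rs n" if "open V" "L \<in> \<L>" "L \<inter> V \<noteq> {}" "\<not> L \<subseteq> Rs n" for V L n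
  proof
    assume sub: "L \<inter> V \<subseteq> Rs n"
    then have "Rs n \<in> \<R>" using Rs that(3) by (metis insertE rangeI subset_empty)
    moreover have "openin (top_of_set L) (L \<inter> V)" using \<open>open V\<close> by (rule openin_open_Int)
    then have "L \<inter> V \<subseteq> (top_of_set L) interior_of (L \<inter> Rs n)"
      using sub by (intro interior_of_maximal) auto
    ultimately have "L \<subseteq> Rs n"
      using resp that(2,3) unfolding respects_family_def respects_set_def by blast
    then show False using that(4) by blast
  qed
  obtain \<sigma> where \<sigma>: "\<And>k L. L \<in> \<L> \<Longrightarrow> \<sigma> k L \<in> \<I>"
    and \<sigma>0: "\<And>k L x. L \<in> \<L> \<Longrightarrow> x \<in> L \<Longrightarrow> g k (\<sigma> k L) x = 0"
  proof
    define \<sigma> where "\<sigma> k L = (SOME s. s \<in> \<I> \<and> (\<forall>x\<in>L. g k s x = 0))" for k L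
    have *: "\<sigma> k L \<in> \<I> \<and> (\<forall>x\<in>L. g k (\<sigma> k L) x = 0)" if "L \<in> \<L>" for k L
      using someI_ex[OF align[OF that, unfolded Bex_def]] unfolding \<sigma>_def .
    show "\<sigma> k L \<in> \<I>" if "L \<in> \<L>" for k L using *[OF that] by blast
    show "g k (\<sigma> k L) x = 0" if "L \<in> \<L>" "x \<in> L" for k L x using *[OF that(1)] that(2) by blast
  qed
  \<comment> \<open>At stage \<open>n\<close> only the heights for the finitely many systems
    \<open>k \<le> n\<close> are bounded by \<open>T\<close>; each system is covered from some stage
    on.\<close>
  define P where "P n p \<longleftrightarrow> (case p of (L, T, U) \<Rightarrow> L \<in> \<L> \<and> open U \<and> L \<inter> U \<noteq> {} \<and> compact (closure U)
      \<and> closure U \<subseteq> W \<and> 0 < T \<and> real n \<le> T \<and> (\<forall>k\<le>n. h k (\<sigma> k L) \<le> T))" for n p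
  \<comment> \<open>The function of the old \<open>L\<close> is compared with \<open>f k\<close> at
    the new time \<open>T'\<close>: as \<open>f k\<close> is non-increasing, this serves every
    \<open>t\<close> between \<open>T\<close> and \<open>T'\<close>.\<close>
  define Q :: "nat \<Rightarrow> 'y set \<times> real \<times> 'y set \<Rightarrow> 'y set \<times> real \<times> 'y set \<Rightarrow> bool"
    where "Q n p q \<longleftrightarrow> (case (p, q) of ((L, T, U), (L', T', U')) \<Rightarrow> closure U' \<subseteq> U
      \<and> closure U' \<inter> Rs n = {} \<and> (\<forall>k\<le>n. \<forall>x\<in>U'. g k (\<sigma> k L) x < f k T'))" for n p q
  have "\<exists>F. \<forall>n. P n (F n) \<and> Q n (F n) (F (Suc n))"
  proof (rule dependent_nat_choice)
    from W obtain x where x: "x \<in> L0" "x \<in> W" by auto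
    obtain U where "open U" "x \<in> U" "closure U \<subseteq> W" "compact (closure U)"
      using locally_compact_neighbourhood[OF lc W(1) x(2)] by blast
    then have "P 0 (L0, max 1 (h 0 (\<sigma> 0 L0)), U)"
      unfolding P_def using x W by auto
    then show "\<exists>p. P 0 p" ..
  next
    fix p n
    assume "P n p"
    obtain L T U where p: "p = (L, T, U)" by (cases p)
    have LTU: "L \<in> \<L>" "open U" "L \<inter> U \<noteq> {}" "closure U \<subseteq> W" "0 < T" "real n \<le> T"
      using \<open>P n p\<close> unfolding P_def p by auto
    obtain L' y where L': "L' \<in> \<L>" "y \<in> L'" "y \<in> L" "y \<in> U" "\<not> L' \<subseteq> Rs n"
      using step_Rs[OF LTU(2,1,3), of n] by blast
    \<comment> \<open>The sum is a crude bound for finitely many heights, and the summand 1 gives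
      \<open>Suc n \<le> T'\<close>. \<open>T'\<close> depends only on \<open>L'\<close>, so it can
      be fixed before the neighbourhood is shrunk.\<close>
    define T' where "T' = T + 1 + (\<Sum>k\<le>Suc n. \<bar>h k (\<sigma> k L')\<bar>)"
    have "0 \<le> (\<Sum>k\<le>Suc n. \<bar>h k (\<sigma> k L')\<bar>)" by (intro sum_nonneg) auto
    then have T': "T + 1 \<le> T'" unfolding T'_def by simp
    have h: "h k (\<sigma> k L') \<le> T'" if "k \<le> Suc n" for k
    proof -
      have "\<bar>h k (\<sigma> k L')\<bar> \<le> (\<Sum>k\<le>Suc n. \<bar>h k (\<sigma> k L')\<bar>)"
        using that by (intro member_le_sum) auto
      then show ?thesis unfolding T'_def using \<open>0 < T\<close> by linarith
    qed
    define V where "V = U \<inter> (\<Inter>k\<le>n. {x. g k (\<sigma> k L) x < f k T'})"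
    have "open {x. g k (\<sigma> k L) x < f k T'}" for k
      using cont[OF \<sigma>[OF LTU(1)]] by (intro open_Collect_less) auto
    then have "open V" unfolding V_def using LTU(2) by (intro open_Int open_INT) auto
    \<comment> \<open>As \<open>y \<in> L\<close>, the functions chosen for \<open>L\<close> vanish
      at \<open>y\<close>, while \<open>f k T'\<close> is positive.\<close>
    moreover have "y \<in> V"
      unfolding V_def using L' LTU \<sigma>0 pos T' by auto
    ultimately have "\<not> L' \<inter> V \<subseteq> Rs n" using avoid[of V L' n] L'(1,2,5) by blast
    \<comment> \<open>The point \<open>y\<close> may lie in \<open>Rs n\<close>, so the next
      neighbourhood is centred at another point of \<open>L'\<close>.\<close>
    then obtain z where z: "z \<in> L'" "z \<in> V - Rs n" by blast
    have "open (V - Rs n)" using \<open>open V\<close> closed_Rs by (rule open_Diff)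
    then obtain U' where U': "open U'" "z \<in> U'" "closure U' \<subseteq> V - Rs n" "compact (closure U')"
      using locally_compact_neighbourhood[OF lc _ z(2)] by blast
    have "closure U' \<subseteq> U" using U' unfolding V_def by auto
    then have "closure U' \<subseteq> W" using LTU(4) closure_subset by blast
    then have "P (Suc n) (L', T', U')"
      unfolding P_def using L' U' z h T' LTU by auto
    moreover have "Q n p (L', T', U')"
      unfolding Q_def p using U' \<open>closure U' \<subseteq> U\<close> closure_subset[of U'] unfolding V_def by auto
    ultimately show "\<exists>q. P (Suc n) q \<and> Q n p q" by blast
  qed
  then obtain F where PF: "\<And>n. P n (F n)" and QF: "\<And>n. Q n (F n) (F (Suc n))" by blast
  define L where "L n = fst (F n)" for n
  define T where "T n = fst (snd (F n))" for n
  define U where "U n = snd (snd (F n))" for n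
  have F: "F n = (L n, T n, U n)" for n by (simp add: L_def T_def U_def)
  have L: "L n \<in> \<L>" "L n \<inter> U n \<noteq> {}" "compact (closure (U n))" "closure (U n) \<subseteq> W"
      "0 < T n" "real n \<le> T n" and hT: "\<And>k. k \<le> n \<Longrightarrow> h k (\<sigma> k (L n)) \<le> T n" for n
    using PF[of n] unfolding P_def F by auto
  have nest: "closure (U (Suc n)) \<subseteq> U n" "closure (U (Suc n)) \<inter> Rs n = {}"
    and small: "\<And>k x. k \<le> n \<Longrightarrow> x \<in> U (Suc n) \<Longrightarrow> g k (\<sigma> k (L n)) x < f k (T (Suc n))" for n
    using QF[of n] unfolding Q_def F by auto
  have mono: "closure (U n) \<subseteq> closure (U m)" if "m \<le> n" for m n
    using that
  proof (rule lift_Suc_antimono_le[rotated])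
    show "closure (U (Suc n)) \<subseteq> closure (U n)" for n
      using nest(1)[of n] closure_subset by blast
  qed
  have "closure (U 0) \<inter> (\<Inter>n\<in>UNIV. closure (U n)) \<noteq> {}"
  proof (rule compact_imp_fip_image[OF L(3)])
    fix I :: "nat set" assume "finite I"
    then have "closure (U (Max (insert 0 I))) \<subseteq> closure (U 0) \<inter> (\<Inter>n\<in>I. closure (U n))"
      using mono by (intro Int_greatest INT_greatest) auto
    then show "closure (U 0) \<inter> (\<Inter>n\<in>I. closure (U n)) \<noteq> {}"
      using L(2)[of "Max (insert 0 I)"] closure_subset by blast
  qed auto
  then obtain x where x: "x \<in> closure (U n)" for n by blast
  then have xU: "x \<in> U n" for n using nest(1) by blast
  have "x \<in> W" using x L(4) by blast
  moreover have "x \<notin> \<Union>\<R>"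
  proof
    assume "x \<in> \<Union>\<R>"
    then obtain n where "x \<in> Rs n" using Rs by (metis UnionE insertI2 rangeE)
    then show False using nest(2)[of n] x by blast
  qed
  moreover have "\<forall>\<^sub>F t in at_top. \<exists>s\<in>\<I>. g k s x \<le> f k t \<and> h k s \<le> t" for k
  proof (rule eventually_at_top_linorderI)
    \<comment> \<open>Starting at \<open>T k\<close> makes the straddling index at least
      \<open>k\<close>, so the bounds at that stage include system \<open>k\<close>.\<close>
    fix t assume "T k \<le> t"
    then obtain n where n: "k \<le> n" "T n \<le> t" "t < T (Suc n)"
      using exists_straddling_step[of T k t] L(6) by blast
    have "f k (T (Suc n)) \<le> f k t"
      using anti[of k] n L(5)[of n] unfolding monotone_on_def by auto
    then show "\<exists>s\<in>\<I>. g k s x \<le> f k t \<and> h k s \<le> t"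
      using small[OF n(1) xU] hT[OF n(1)] n \<sigma>[OF L(1)]
      by (intro bexI[of _ "\<sigma> k (L n)"]) force+
  qed
  ultimately show ?thesis by blast
qed

text \<open>If \<open>{p}\<close> has interior in \<open>L\<close>, then \<open>p\<close> is
  isolated in \<open>L\<close>, so \<open>L\<close> is connected; as \<open>{p}\<close> is clopen in
  \<open>L\<close>, it is all of \<open>L\<close>.\<close>

lemma respects_set_singleton:
  assumes iso: "\<And>L. L \<in> \<L> \<Longrightarrow> connected L \<or> \<not> (\<exists>x. x isolated_in L)"
  shows "respects_set \<L> {p}"
  unfolding respects_set_def
proof (intro ballI impI)
  fix L assume "L \<in> \<L>" and int: "(top_of_set L) interior_of (L \<inter> {p}) \<noteq> {}"
  have "(top_of_set L) interior_of (L \<inter> {p}) \<subseteq> L \<inter> {p}" by (rule interior_of_subset)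
  with int have "p \<in> L" "(top_of_set L) interior_of (L \<inter> {p}) = {p}" by auto
  then have op: "openin (top_of_set L) {p}" by (metis openin_interior_of)
  then have "p isolated_in L"
    unfolding isolated_in_def openin_open using \<open>p \<in> L\<close> by auto
  then have "connected L" using iso \<open>L \<in> \<L>\<close> by blast
  moreover have "closedin (top_of_set L) {p}"
    using \<open>p \<in> L\<close> by (intro closed_subset) auto
  ultimately have "{p} = L" using op unfolding connected_clopen by blast
  then show "L \<subseteq> {p}" by simp
qed

text \<open>The second claim asks for a member of \<open>\<L>\<close> with two points: if
  \<open>'y\<close> is countable, discrete and has at least two points, \<open>\<L>\<close> consists
  of all singletons and \<open>\<R>\<close> is empty, the set in question is countable.\<close>

theorem theorem1p5:
  fixes \<I> :: "'i set"
    and \<X> :: "nat \<Rightarrow> ('x, 'i) dioph_system"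
    and f :: "nat \<Rightarrow> real \<Rightarrow> real"
    and \<phi> :: "nat \<Rightarrow> 'y::metric_space \<Rightarrow> 'x"
    and \<L> \<R> :: "'y set set"
  assumes "locally compact (UNIV :: 'y set)"
    and "countable \<I>"
    and "\<And>k. diophantine_system (\<X> k)"
    and "\<And>k. index_set (\<X> k) = \<I>"
    and "\<And>k t. t > 0 \<Longrightarrow> f k t > 0"
    and "\<And>k. antimono_on {0<..} (f k)"
    and "\<And>k. continuous_map euclidean (space_of (\<X> k)) (\<phi> k)"
    and "countable \<L>" and "countable \<R>"
    and "\<And>L. L \<in> \<L> \<Longrightarrow> closed L" and "\<And>R. R \<in> \<R> \<Longrightarrow> closed R"
    and "totally_dense_rel \<L> \<R>"
    and "respects_family \<L> \<R>"
    and "\<And>k. aligned_via \<L> (\<X> k) (\<phi> k)"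
  shows "closure ((\<Inter>k. \<phi> k -` UA (\<X> k) (f k)) - \<Union>\<R>) = UNIV \<and>
    ((\<forall>L\<in>\<L>. connected L \<or> \<not> (\<exists>x. x isolated_in L)) \<and>
     (\<exists>L\<in>\<L>. \<exists>x\<in>L. \<exists>y\<in>L. x \<noteq> y) \<longrightarrow>
     uncountable ((\<Inter>k. \<phi> k -` UA (\<X> k) (f k)) - \<Union>\<R>))"
proof -
  define g where "g k s y = dist_fun (\<X> k) s (\<phi> k y)" for k s y
  define S where "S = (\<Inter>k. \<phi> k -` UA (\<X> k) (f k))"
  have cont: "continuous_on UNIV (g k s)" if "s \<in> \<I>" for k s
  proof -
    have "continuous_map (space_of (\<X> k)) euclidean (dist_fun (\<X> k) s)"
      using assms(3)[of k] that assms(4)[of k]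
      unfolding diophantine_system_def by (metis continuous_map_into_fulltopology)
    from continuous_map_compose[OF assms(7) this] show ?thesis
      by (simp add: g_def[abs_def] o_def)
  qed
  have align: "\<exists>s\<in>\<I>. \<forall>x\<in>L. g k s x = 0" if "L \<in> \<L>" for k L
    using assms(14)[of k] that assms(4)[of k] unfolding aligned_via_def g_def by auto
  have "\<phi> k x \<in> topspace (space_of (\<X> k))" for k x
    using continuous_map_image_subset_topspace[OF assms(7)[of k]] by auto
  then have S_iff: "x \<in> S \<longleftrightarrow>
      (\<forall>k. \<forall>\<^sub>F t in at_top. \<exists>s\<in>\<I>. g k s x \<le> f k t \<and> height (\<X> k) s \<le> t)" for x
    by (simp add: S_def UA_def assms(4) g_def)
  have step: "\<exists>L'\<in>\<L>. L' \<inter> L \<inter> W \<noteq> {} \<and> \<not> L' \<subseteq> R"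
    if "open W" "L \<in> \<L>" "L \<inter> W \<noteq> {}" "R \<in> \<R>" for W L R
    using assms(12) that unfolding totally_dense_rel_def by blast
  have dense: "closure (\<Union>\<L>) = UNIV"
    using assms(12) unfolding totally_dense_rel_def by blast
  have "\<exists>x\<in>S - \<Union>\<R>. x \<in> W" if W: "open W" "W \<noteq> {}" for W
  proof -
    have "\<Union>\<L> \<inter> W \<noteq> {}"
      using dense open_Int_closure_eq_empty[OF W(1), of "\<Union>\<L>"] W(2) by (simp add: Int_commute)
    then obtain L where L: "L \<in> \<L>" "L \<inter> W \<noteq> {}" by blast
    have "\<exists>x\<in>W - \<Union>\<R>. x \<in> S"
      unfolding S_iff
      by (rule exists_uniform_point[where f = f and \<L> = \<L> and ?L0.0 = L])
        (fact assms cont align step W L)+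
    then show ?thesis by blast
  qed
  then have "y \<in> closure (S - \<Union>\<R>)" for y
    unfolding closure_iff_nhds_not_empty by (metis disjoint_iff empty_iff subsetD)
  then have "closure (S - \<Union>\<R>) = UNIV" by blast
  moreover have "uncountable (S - \<Union>\<R>)"
    if iso: "\<forall>L\<in>\<L>. connected L \<or> \<not> (\<exists>x. x isolated_in L)"
      and two: "\<exists>L\<in>\<L>. \<exists>x\<in>L. \<exists>y\<in>L. x \<noteq> y"
  proof
    assume "countable (S - \<Union>\<R>)"
    define \<L>' where "\<L>' = {L \<in> \<L>. \<exists>x\<in>L. \<exists>y\<in>L. x \<noteq> y}"
    define \<R>' where "\<R>' = \<R> \<union> (\<lambda>p. {p}) ` (S - \<Union>\<R>)"
    have "countable \<R>'"
      unfolding \<R>'_def using assms(9) \<open>countable (S - \<Union>\<R>)\<close> by auto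
    have closed': "closed R" if "R \<in> \<R>'" for R
      using that assms(11) unfolding \<R>'_def by auto
    have align': "\<exists>s\<in>\<I>. \<forall>x\<in>L. g k s x = 0" if "L \<in> \<L>'" for k L
      using that align unfolding \<L>'_def by auto
    have step': "\<exists>L'\<in>\<L>'. L' \<inter> L \<inter> W \<noteq> {} \<and> \<not> L' \<subseteq> R"
      if W: "open W" "L \<in> \<L>'" "L \<inter> W \<noteq> {}" "R \<in> \<R>'" for W L R
    proof (cases "L \<subseteq> R")
      case False
      then show ?thesis using W by (intro bexI[of _ L]) auto
    next
      case True
      \<comment> \<open>\<open>L\<close> has two points, so it is not contained in an added
        singleton.\<close>
      then have "R \<in> \<R>" using W(2,4) unfolding \<L>'_def \<R>'_def by blast
      have "L \<in> \<L>" using W(2) unfolding \<L>'_def by blast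
      obtain L' where L': "L' \<in> \<L>" "L' \<inter> L \<inter> W \<noteq> {}" "\<not> L' \<subseteq> R"
        using step[OF W(1) \<open>L \<in> \<L>\<close> W(3) \<open>R \<in> \<R>\<close>] by blast
      \<comment> \<open>As \<open>a \<in> L \<subseteq> R\<close> and \<open>b\<close> is outside
        \<open>R\<close>, these are two points of \<open>L'\<close>, which therefore survives in
        \<open>\<L>'\<close>.\<close>
      obtain a b where "a \<in> L' \<inter> L" "b \<in> L' - R" using L' by blast
      then have "a \<in> L'" "b \<in> L'" "a \<noteq> b" using True by auto
      then have "L' \<in> \<L>'" using \<open>L' \<in> \<L>\<close> unfolding \<L>'_def by blast
      then show ?thesis using L' by blast
    qed
    have "respects_set \<L>' R" if R: "R \<in> \<R>'" for R
    proof (cases "R \<in> \<R>")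
      case True
      then show ?thesis
        using assms(13) unfolding respects_family_def respects_set_def \<L>'_def by blast
    next
      case False
      then obtain p where "R = {p}" using R unfolding \<R>'_def by blast
      then show ?thesis using iso respects_set_singleton[of \<L>'] unfolding \<L>'_def by blast
    qed
    then have resp': "respects_family \<L>' \<R>'" unfolding respects_family_def by blast
    \<comment> \<open>One starting set suffices, with \<open>W\<close> the whole space: a point of
      \<open>S\<close> outside \<open>\<Union>\<R>'\<close> would lie in
      \<open>S - \<Union>\<R>\<close>, all of whose points were removed.\<close>
    obtain L where L: "L \<in> \<L>'" "L \<inter> UNIV \<noteq> {}" using two unfolding \<L>'_def by blast
    have "\<exists>x\<in>UNIV - \<Union>\<R>'. x \<in> S"
      unfolding S_iff
      by (rule exists_uniform_point[where f = f and \<L> = \<L>' and ?L0.0 = L])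
        (fact assms cont align' \<open>countable \<R>'\<close> closed' step' resp' open_UNIV L)+
    then show False unfolding \<R>'_def by blast
  qed
  ultimately show ?thesis unfolding S_def by blast
qed

end
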